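(* Let $m \ge 1$ and $N \ge 1$ be integers, and let $X_1, \dots, X_m$, $F_1,\dots,F_m$, $G$ and $A_{(i_1,\dots,i_m)}$ (for all nonnegative integers $i_1,\dots,i_m$ with $2 \le i_1+\cdots+i_m \le N$) be $n\times n$ complex matrices such that $$\sum_{k=2}^{N}\ \sum_{\substack{i_1,\dots,i_m \ge 0\\ i_1+\cdots+i_m = k}} A_{(i_1,\dots,i_m)} X_1^{i_1} X_2^{i_2}\cdots X_m^{i_m} + \sum_{s=1}^m F_s X_s + G = 0 .$$ Suppose that the matrices $X_1,\dots,X_m$ have a common set of right eigenvectors corresponding to all their eigenvalues (not necessarily the same eigenvalues for different $X_s$). Then all the eigenvalues of $X_1,\dots,X_m$ are zeros of the multivariate determinantal polynomial $$\det\left(\sum_{k=2}^{N}\ \sum_{\substack{i_1,\dots,i_m \ge 0\\ i_1+\cdots+i_m = k}} \mu_1^{i_1} \mu_2^{i_2}\cdots \mu_m^{i_m} A_{(i_1,\dots,i_m)} + \sum_{s=1}^m \mu_s F_s + G\right),$$ in the sense that this determinant vanishes at every tuple $(\mu_1,\dots,\mu_m)$ of corresponding eigenvalues of $X_1,\dots,X_m$.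
   Context: A tuple $(\mu_1,\dots,\mu_m)$, with $\mu_s$ an eigenvalue of $X_s$, is called a tuple of corresponding eigenvalues if there is a nonzero column vector $v$ (a common right eigenvector) with $X_s v = \mu_s v$ for all $s = 1,\dots,m$. "The matrices have a common set of right eigenvectors corresponding to all their eigenvalues" means that, for every $s$, every eigenvalue of $X_s$ occurs as the $s$-th entry of some tuple of corresponding eigenvalues. *)

theory Defs
  imports "Jordan_Normal_Form.Char_Poly"
begin

text \<open>
  A family \<open>(y\<^sub>1, \<dots>, y\<^sub>m)\<close> is a function on \<^typ>\<open>nat\<close> used on \<^term>\<open>{1..m}\<close> only.
  A multi-index is extended by 0 outside \<^term>\<open>{1..m}\<close>, so that each tuple
  \<open>(i\<^sub>1, \<dots>, i\<^sub>m)\<close> is represented by exactly one function.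
\<close>

definition multi_indices :: "nat \<Rightarrow> nat \<Rightarrow> (nat \<Rightarrow> nat) set" where
  "multi_indices m k = {i. (\<forall>s. s \<notin> {1..m} \<longrightarrow> i s = 0) \<and> (\<Sum>s = 1..m. i s) = k}"

text \<open>
  Matrices of a fixed size are not a type, hence sums of them are taken with
  \<^const>\<open>finsum\<close> in the following module. Since \<^const>\<open>finsum\<close> is zero on infinite
  index sets, finiteness of the index sets matters.
\<close>

abbreviation mats :: "nat \<Rightarrow> (complex, complex mat) module" where
  "mats n \<equiv> module_mat TYPE(complex) n n"

lemma finite_multi_indices: "finite (multi_indices m k)"
proof -
  have "multi_indices m k \<subseteq> {i. \<forall>s. (s \<in> {1..m} \<longrightarrow> i s \<in> {..k}) \<and> (s \<notin> {1..m} \<longrightarrow> i s = 0)}"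
  proof (clarsimp simp: multi_indices_def)
    fix i :: "nat \<Rightarrow> nat" and s
    assume "Suc 0 \<le> s" "s \<le> m"
    then show "i s \<le> sum i {Suc 0..m}"
      by (intro member_le_sum) auto
  qed
  moreover have "finite {i. \<forall>s. (s \<in> {1..m} \<longrightarrow> i s \<in> {..k}) \<and> (s \<notin> {1..m} \<longrightarrow> i s = (0::nat))}"
    by (rule finite_set_of_finite_funs) auto
  ultimately show ?thesis
    by (rule finite_subset)
qed

text \<open>The ordered product \<open>X\<^sub>1\<^bsup>i\<^sub>1\<^esup> \<cdots> X\<^sub>m\<^bsup>i\<^sub>m\<^esup>\<close>; the \<open>X\<^sub>s\<close> need not commute.\<close>

definition mat_monomial :: "nat \<Rightarrow> nat \<Rightarrow> (nat \<Rightarrow> complex mat) \<Rightarrow> (nat \<Rightarrow> nat) \<Rightarrow> complex mat" where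
  "mat_monomial n m X i = foldr (\<lambda>s P. X s ^\<^sub>m i s * P) [1..<Suc m] (1\<^sub>m n)"

definition corresponding_eigenvalues ::
  "nat \<Rightarrow> (nat \<Rightarrow> complex mat) \<Rightarrow> (nat \<Rightarrow> complex) \<Rightarrow> bool" where
  "corresponding_eigenvalues m X \<mu> \<longleftrightarrow> (\<exists>v. \<forall>s \<in> {1..m}. eigenvector (X s) v (\<mu> s))"

definition common_eigenvectors_for_all_eigenvalues :: "nat \<Rightarrow> (nat \<Rightarrow> complex mat) \<Rightarrow> bool" where
  "common_eigenvectors_for_all_eigenvalues m X \<longleftrightarrow>
     (\<forall>s \<in> {1..m}. \<forall>x. eigenvalue (X s) x \<longrightarrow>
        (\<exists>\<mu>. corresponding_eigenvalues m X \<mu> \<and> \<mu> s = x))"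

end

theory Submission
  imports Defs
begin

text \<open>
  Let \<open>v\<close> be a common eigenvector with eigenvalues \<open>\<mu>\<^sub>1, \<dots>, \<mu>\<^sub>m\<close>. In the ordered product
  \<open>X\<^sub>1\<^bsup>i\<^sub>1\<^esup> \<cdots> X\<^sub>m\<^bsup>i\<^sub>m\<^esup> v\<close> the factors can be evaluated from the right, each of them only
  multiplying \<open>v\<close> by a scalar; so the product acts on \<open>v\<close> as \<open>\<mu>\<^sub>1\<^bsup>i\<^sub>1\<^esup> \<cdots> \<mu>\<^sub>m\<^bsup>i\<^sub>m\<^esup>\<close>, although the
  \<open>X\<^sub>s\<close> need not commute (\<open>mat_monomial_mult_eigenvector\<close>). All coefficients stand to the left of
  the \<open>X\<^sub>s\<close>. Therefore the matrix polynomial evaluated at the \<open>X\<^sub>s\<close> and the one evaluated at the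
  scalars \<open>\<mu>\<^sub>s\<close> have the same value on \<open>v\<close>, and agreement on \<open>v\<close> passes from the terms to their
  sum (\<open>finsum_mats_mult_vec_cong\<close>). The former polynomial is the zero matrix, so the latter has
  the nonzero vector \<open>v\<close> in its kernel and its determinant is zero.
\<close>

lemma finsum_mats_closed:
  assumes "\<And>x. x \<in> S \<Longrightarrow> B x \<in> carrier_mat n n"
  shows "(\<Oplus>\<^bsub>mats n\<^esub>x\<in>S. B x) \<in> carrier_mat n n"
proof -
  interpret abelian_group "mats n"
    by (rule abelian_group_mat)
  show ?thesis
    using finsum_closed[of B S] assms by (auto simp: module_mat_simps)
qed

text \<open>
  Applying a matrix to the fixed vector \<open>v\<close> is additive in the matrix, so a sum depends on its
  terms only through their values at \<open>v\<close>. It is stated as a congruence rule so that it nests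
  and handles the double sum over \<open>k\<close> and \<open>i\<close> by two applications.
\<close>

lemma finsum_mats_mult_vec_cong:
  assumes "finite S"
    and "\<And>x. x \<in> S \<Longrightarrow> B x \<in> carrier_mat n n" "\<And>x. x \<in> S \<Longrightarrow> C x \<in> carrier_mat n n"
    and "v \<in> carrier_vec n"
    and "\<And>x. x \<in> S \<Longrightarrow> B x *\<^sub>v v = C x *\<^sub>v v"
  shows "(\<Oplus>\<^bsub>mats n\<^esub>x\<in>S. B x) *\<^sub>v v = (\<Oplus>\<^bsub>mats n\<^esub>x\<in>S. C x) *\<^sub>v v"
  using assms
proof (induction S rule: finite_induct)
  case empty
  interpret abelian_group "mats n"
    by (rule abelian_group_mat)
  show ?case by (simp add: finsum_empty)
next
  case (insert a S)
  interpret abelian_group "mats n"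
    by (rule abelian_group_mat)
  have "(\<Oplus>\<^bsub>mats n\<^esub>x\<in>insert a S. B x) = B a + (\<Oplus>\<^bsub>mats n\<^esub>x\<in>S. B x)"
    and "(\<Oplus>\<^bsub>mats n\<^esub>x\<in>insert a S. C x) = C a + (\<Oplus>\<^bsub>mats n\<^esub>x\<in>S. C x)"
    using insert.hyps insert.prems(1,2) by (subst finsum_insert; auto simp: module_mat_simps)+
  moreover have "(\<Oplus>\<^bsub>mats n\<^esub>x\<in>S. B x) *\<^sub>v v = (\<Oplus>\<^bsub>mats n\<^esub>x\<in>S. C x) *\<^sub>v v"
    using insert.prems by (intro insert.IH) auto
  moreover have "(\<Oplus>\<^bsub>mats n\<^esub>x\<in>S. B x) \<in> carrier_mat n n" "(\<Oplus>\<^bsub>mats n\<^esub>x\<in>S. C x) \<in> carrier_mat n n"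
    using insert.prems(1,2) by (auto intro!: finsum_mats_closed)
  ultimately show ?case
    using insert.prems by (simp add: add_mult_distrib_mat_vec[of _ n n])
qed

lemma smult_mat_mult_vec:
  assumes "B \<in> carrier_mat n k" "v \<in> carrier_vec k"
  shows "(c \<cdot>\<^sub>m B) *\<^sub>v v = c \<cdot>\<^sub>v (B *\<^sub>v v)"
  using assms by (intro eq_vecI) (auto simp: scalar_prod_def sum_distrib_left mult.assoc)

lemma foldr_mult_pow_mat_closed:
  assumes "\<And>s. s \<in> set ss \<Longrightarrow> X s \<in> carrier_mat n n"
  shows "foldr (\<lambda>s P. X s ^\<^sub>m i s * P) ss (1\<^sub>m n) \<in> carrier_mat n n"
  using assms by (induction ss) (auto intro!: mult_carrier_mat[of _ n n] pow_carrier_mat)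

lemma mat_monomial_closed:
  assumes "\<And>s. s \<in> {1..m} \<Longrightarrow> X s \<in> carrier_mat n n"
  shows "mat_monomial n m X i \<in> carrier_mat n n"
  unfolding mat_monomial_def
  by (rule foldr_mult_pow_mat_closed) (use assms in \<open>auto simp del: upt_Suc\<close>)

text \<open>
  The rightmost factor acts first and returns a multiple of \<open>v\<close>, which is again a vector on
  which the next factor acts as a scalar. The induction runs over arbitrary lists of indices,
  since a tail of the list \<open>1, \<dots>, m\<close> is no longer of that form.
\<close>

lemma mat_monomial_mult_eigenvector:
  assumes X: "\<And>s. s \<in> {1..m} \<Longrightarrow> X s \<in> carrier_mat n n"
    and v: "v \<in> carrier_vec n"
    and ev: "\<And>s. s \<in> {1..m} \<Longrightarrow> eigenvector (X s) v (\<mu> s)"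
  shows "mat_monomial n m X i *\<^sub>v v = (\<Prod>s = 1..m. \<mu> s ^ i s) \<cdot>\<^sub>v v"
proof -
  let ?P = "\<lambda>ss. foldr (\<lambda>s P. X s ^\<^sub>m i s * P) ss (1\<^sub>m n)"
  have "?P ss *\<^sub>v v = (\<Prod>s\<leftarrow>ss. \<mu> s ^ i s) \<cdot>\<^sub>v v"
    if "set ss \<subseteq> {1..m}" for ss
    using that
  proof (induction ss)
    case Nil
    then show ?case using v by simp
  next
    case (Cons s ss)
    then have s: "s \<in> {1..m}"
      and IH: "?P ss *\<^sub>v v = (\<Prod>s\<leftarrow>ss. \<mu> s ^ i s) \<cdot>\<^sub>v v"
      by auto
    have P: "?P ss \<in> carrier_mat n n"
      by (rule foldr_mult_pow_mat_closed) (use Cons.prems X in auto)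
    have pow: "X s ^\<^sub>m i s \<in> carrier_mat n n"
      using X[OF s] by (rule pow_carrier_mat)
    have "?P (s # ss) *\<^sub>v v = X s ^\<^sub>m i s *\<^sub>v (?P ss *\<^sub>v v)"
      using pow P v by (simp add: assoc_mult_mat_vec[of _ n n])
    also have "\<dots> = (\<Prod>s\<leftarrow>ss. \<mu> s ^ i s) \<cdot>\<^sub>v (X s ^\<^sub>m i s *\<^sub>v v)"
      using pow v by (simp add: IH mult_mat_vec)
    also have "\<dots> = (\<Prod>s\<leftarrow>s # ss. \<mu> s ^ i s) \<cdot>\<^sub>v v"
      using eigenvector_pow[OF X[OF s] ev[OF s]] by (simp add: smult_smult_assoc mult.commute)
    finally show ?case .
  qed
  from this[of "[1..<Suc m]"] show ?thesis
    unfolding mat_monomial_def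
    by (simp del: upt_Suc add: prod.distinct_set_conv_list[symmetric] subset_iff atLeastLessThanSuc_atLeastAtMost)
qed

theorem lemma6:
  fixes m N n :: nat
    and X F :: "nat \<Rightarrow> complex mat"
    and G :: "complex mat"
    and A :: "(nat \<Rightarrow> nat) \<Rightarrow> complex mat"
  assumes "m \<ge> 1" and "N \<ge> 1"
    and "\<And>s. s \<in> {1..m} \<Longrightarrow> X s \<in> carrier_mat n n"
    and "\<And>s. s \<in> {1..m} \<Longrightarrow> F s \<in> carrier_mat n n"
    and "G \<in> carrier_mat n n"
    and "\<And>k i. k \<in> {2..N} \<Longrightarrow> i \<in> multi_indices m k \<Longrightarrow> A i \<in> carrier_mat n n"
    and "(\<Oplus>\<^bsub>mats n\<^esub>k\<in>{2..N}. \<Oplus>\<^bsub>mats n\<^esub>i\<in>multi_indices m k. A i * mat_monomial n m X i)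
           + (\<Oplus>\<^bsub>mats n\<^esub>s\<in>{1..m}. F s * X s) + G = 0\<^sub>m n n"
    and "common_eigenvectors_for_all_eigenvalues m X"
  shows "\<forall>\<mu>. corresponding_eigenvalues m X \<mu> \<longrightarrow>
           det ((\<Oplus>\<^bsub>mats n\<^esub>k\<in>{2..N}. \<Oplus>\<^bsub>mats n\<^esub>i\<in>multi_indices m k. (\<Prod>s = 1..m. \<mu> s ^ i s) \<cdot>\<^sub>m A i)
                + (\<Oplus>\<^bsub>mats n\<^esub>s\<in>{1..m}. \<mu> s \<cdot>\<^sub>m F s) + G) = 0"
proof (intro allI impI)
  fix \<mu> assume "corresponding_eigenvalues m X \<mu>"
  then obtain v where ev: "\<And>s. s \<in> {1..m} \<Longrightarrow> eigenvector (X s) v (\<mu> s)"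
    unfolding corresponding_eigenvalues_def by blast
  \<comment> \<open>The dimension of \<open>v\<close> and \<open>v \<noteq> 0\<close> are read off from \<open>X\<^sub>1\<close>, hence \<open>m \<ge> 1\<close>.\<close>
  have v: "v \<in> carrier_vec n" "v \<noteq> 0\<^sub>v n"
    using ev[of 1] assms(1) assms(3)[of 1] by (auto simp: eigenvector_def)
  have Xv: "X s *\<^sub>v v = \<mu> s \<cdot>\<^sub>v v" if "s \<in> {1..m}" for s
    using ev[OF that] by (simp add: eigenvector_def)
  note mono = mat_monomial_closed[of m X n, OF assms(3)]
  let ?AX = "\<lambda>i. A i * mat_monomial n m X i"
  let ?A\<mu> = "\<lambda>i. (\<Prod>s = 1..m. \<mu> s ^ i s) \<cdot>\<^sub>m A i"
  let ?SX = "\<Oplus>\<^bsub>mats n\<^esub>k\<in>{2..N}. \<Oplus>\<^bsub>mats n\<^esub>i\<in>multi_indices m k. ?AX i"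
  let ?S\<mu> = "\<Oplus>\<^bsub>mats n\<^esub>k\<in>{2..N}. \<Oplus>\<^bsub>mats n\<^esub>i\<in>multi_indices m k. ?A\<mu> i"
  let ?TX = "\<Oplus>\<^bsub>mats n\<^esub>s\<in>{1..m}. F s * X s"
  let ?T\<mu> = "\<Oplus>\<^bsub>mats n\<^esub>s\<in>{1..m}. \<mu> s \<cdot>\<^sub>m F s"
  have AX: "?AX i \<in> carrier_mat n n" and A\<mu>: "?A\<mu> i \<in> carrier_mat n n"
    and A_eq: "?AX i *\<^sub>v v = ?A\<mu> i *\<^sub>v v" if "k \<in> {2..N}" "i \<in> multi_indices m k" for k i
  proof -
    note Ai = assms(6)[OF that]
    show "?AX i \<in> carrier_mat n n" "?A\<mu> i \<in> carrier_mat n n"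
      using Ai mono by auto
    have "?AX i *\<^sub>v v = A i *\<^sub>v (mat_monomial n m X i *\<^sub>v v)"
      by (rule assoc_mult_mat_vec[OF Ai mono v(1)])
    also have "mat_monomial n m X i *\<^sub>v v = (\<Prod>s = 1..m. \<mu> s ^ i s) \<cdot>\<^sub>v v"
      by (rule mat_monomial_mult_eigenvector[OF assms(3) v(1) ev])
    also have "A i *\<^sub>v ((\<Prod>s = 1..m. \<mu> s ^ i s) \<cdot>\<^sub>v v) = ?A\<mu> i *\<^sub>v v"
      using Ai v(1) by (simp add: mult_mat_vec smult_mat_mult_vec)
    finally show "?AX i *\<^sub>v v = ?A\<mu> i *\<^sub>v v" .
  qed
  have FX: "F s * X s \<in> carrier_mat n n" and F\<mu>: "\<mu> s \<cdot>\<^sub>m F s \<in> carrier_mat n n"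
    and F_eq: "(F s * X s) *\<^sub>v v = (\<mu> s \<cdot>\<^sub>m F s) *\<^sub>v v" if "s \<in> {1..m}" for s
  proof -
    note Fs = assms(4)[OF that] and Xs = assms(3)[OF that]
    show "F s * X s \<in> carrier_mat n n" "\<mu> s \<cdot>\<^sub>m F s \<in> carrier_mat n n"
      using Fs Xs by auto
    show "(F s * X s) *\<^sub>v v = (\<mu> s \<cdot>\<^sub>m F s) *\<^sub>v v"
      using assoc_mult_mat_vec[OF Fs Xs v(1)] Xv[OF that] Fs v(1)
      by (simp add: mult_mat_vec smult_mat_mult_vec)
  qed
  have carriers: "?SX \<in> carrier_mat n n" "?S\<mu> \<in> carrier_mat n n"
    "?TX \<in> carrier_mat n n" "?T\<mu> \<in> carrier_mat n n"
    by (intro finsum_mats_closed AX A\<mu> FX F\<mu>; assumption)+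
  have S_eq: "?SX *\<^sub>v v = ?S\<mu> *\<^sub>v v"
    by (intro finsum_mats_mult_vec_cong finsum_mats_closed finite_multi_indices finite_atLeastAtMost
        A_eq AX A\<mu> v(1); assumption)
  have T_eq: "?TX *\<^sub>v v = ?T\<mu> *\<^sub>v v"
    by (intro finsum_mats_mult_vec_cong finite_atLeastAtMost F_eq FX F\<mu> v(1))
  have "(?S\<mu> + ?T\<mu> + G) *\<^sub>v v = (?SX + ?TX + G) *\<^sub>v v"
    using carriers assms(5) v(1) S_eq T_eq
    by (simp add: add_mult_distrib_mat_vec[of _ n n])
  also have "\<dots> = 0\<^sub>v n"
    unfolding assms(7) using v(1) by (intro eq_vecI) auto
  finally have "(?S\<mu> + ?T\<mu> + G) *\<^sub>v v = 0\<^sub>v n" .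
  moreover have "?S\<mu> + ?T\<mu> + G \<in> carrier_mat n n"
    using carriers assms(5) by simp
  ultimately show "det (?S\<mu> + ?T\<mu> + G) = 0"
    using v det_0_iff_vec_prod_zero by blast
qed

end
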